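(* For all $n \ge 1$, let $\mathcal H_{2n-1}=\{x_i-x_j=y_i:1\le i<j\le n+1\}$ be the arrangement in $\mathbb R^{2n+2}$ and let $\hat 0,\hat 1$ be the minimum and maximum of its intersection lattice. Then $$\mu_{\mathcal L(\mathcal H_{2n-1})}(\hat{0},\hat{1}) = -|\mathcal{DC}_{2n}| = -g_{n}.$$
   Context: $\mathcal L(\mathcal A)$ is the intersection lattice of an arrangement (nonempty intersections of hyperplanes ordered by reverse inclusion), and $\mu$ its Möbius function. A D-permutation of $[2n]$ is a permutation $\sigma$ with $i\le\sigma(i)$ for odd $i$ and $i\ge\sigma(i)$ for even $i$; $\mathcal{DC}_{2n}$ is the set of D-permutations of $[2n]$ consisting of a single cycle. A Dumont permutation is a $\sigma\in\mathfrak S_{2N}$ with $2i>\sigma(2i)$ and $2i-1\le\sigma(2i-1)$ for all $i=1,\dots,N$. For $n\ge1$, the Genocchi number $g_n$ is the number of Dumont permutations in $\mathfrak S_{2n-2}$ (with $g_1=1$). *)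

theory Defs
  imports
    Complex_Main
    "HOL-Algebra.Lattice"
    "HOL-Combinatorics.Permutations"
    "HOL-Combinatorics.Orbits"
    "Jordan_Normal_Form.Matrix"
begin

text \<open>Usual recursion: \<open>\<mu>(x,x) = 1\<close> and \<open>\<mu>(x,y) = - (\<Sum>x \<le> z < y. \<mu>(x,z))\<close> for \<open>x < y\<close>.
  The first two conditions of the test only serve to make the recursion terminate; pairs with
  \<open>x \<le> y\<close> false get the value 0.\<close>

function moebius :: "('a, 'b) gorder_scheme \<Rightarrow> 'a \<Rightarrow> 'a \<Rightarrow> int" where
  "moebius L x y =
     (if partial_order L \<and> finite \<lbrace>x..y\<rbrace>\<^bsub>L\<^esub> \<and> x \<in> carrier L \<and> y \<in> carrier L \<and> x \<sqsubseteq>\<^bsub>L\<^esub> y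
      then if x = y then 1 else - (\<Sum>z \<in> \<lbrace>x..y\<rbrace>\<^bsub>L\<^esub> - {y}. moebius L x z)
      else 0)"
  by pat_completeness auto

termination
proof (relation "measure (\<lambda>(L, x, y). card \<lbrace>x..y\<rbrace>\<^bsub>L\<^esub>)", goal_cases)
  case 1
  show ?case by simp
next
  case (2 L x y z)
  then interpret partial_order L by blast
  from 2 have z: "z \<in> carrier L" "x \<sqsubseteq>\<^bsub>L\<^esub> z" "z \<sqsubseteq>\<^bsub>L\<^esub> y" "z \<noteq> y"
    and y: "y \<in> carrier L" "x \<sqsubseteq>\<^bsub>L\<^esub> y" and x: "x \<in> carrier L"
    and fin: "finite \<lbrace>x..y\<rbrace>\<^bsub>L\<^esub>"
    by (auto simp: at_least_at_most_def)
  have "\<lbrace>x..z\<rbrace>\<^bsub>L\<^esub> \<subseteq> \<lbrace>x..y\<rbrace>\<^bsub>L\<^esub>"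
    using z y by (auto simp: at_least_at_most_def intro: le_trans)
  moreover have "y \<notin> \<lbrace>x..z\<rbrace>\<^bsub>L\<^esub>" "y \<in> \<lbrace>x..y\<rbrace>\<^bsub>L\<^esub>"
    using z y le_antisym by (auto simp: at_least_at_most_def)
  ultimately have "\<lbrace>x..z\<rbrace>\<^bsub>L\<^esub> \<subset> \<lbrace>x..y\<rbrace>\<^bsub>L\<^esub>"
    by blast
  with fin show ?case
    by (simp add: psubset_card_mono)
qed

declare moebius.simps [simp del]

text \<open>\<open>V\<close> is the ambient space; it is the intersection of the empty subfamily, hence the minimum.\<close>

definition intersection_lattice :: "'a set \<Rightarrow> 'a set set \<Rightarrow> 'a set gorder" where
  "intersection_lattice V A =
     \<lparr>carrier = {X. X \<noteq> {} \<and> (\<exists>B \<subseteq> A. X = V \<inter> \<Inter>B)},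
      eq = (=),
      le = (\<lambda>X Y. Y \<subseteq> X)\<rparr>"

lemma partial_order_intersection_lattice:
  "partial_order (intersection_lattice V A)"
  by unfold_locales (auto simp: intersection_lattice_def)

lemma finite_intersection_lattice:
  assumes "finite A"
  shows "finite (carrier (intersection_lattice V A))"
proof (rule finite_subset)
  show "carrier (intersection_lattice V A) \<subseteq> (\<lambda>B. V \<inter> \<Inter>B) ` Pow A"
    by (auto simp: intersection_lattice_def)
qed (use assms in simp)

text \<open>A vector \<open>v\<close> of dimension \<open>2n + 2\<close> is read as \<open>(x\<^sub>1, \<dots>, x\<^sub>n\<^sub>+\<^sub>1, y\<^sub>1, \<dots>, y\<^sub>n\<^sub>+\<^sub>1)\<close>. Vector entries
  are numbered from 0, so \<open>x\<^sub>i = v $ (i - 1)\<close> and \<open>y\<^sub>i = v $ (n + i)\<close>. The argument of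
  \<open>linial_arrangement\<close> is \<open>n\<close>, i.e. \<open>linial_arrangement n\<close> is the arrangement
  usually indexed by \<open>2n - 1\<close>.\<close>

definition linial_hyperplane :: "nat \<Rightarrow> nat \<Rightarrow> nat \<Rightarrow> real vec set" where
  "linial_hyperplane n i j =
     {v \<in> carrier_vec (2 * n + 2). v $ (i - 1) - v $ (j - 1) = v $ (n + i)}"

definition linial_arrangement :: "nat \<Rightarrow> real vec set set" where
  "linial_arrangement n = {linial_hyperplane n i j | i j. 1 \<le> i \<and> i < j \<and> j \<le> n + 1}"

definition linial_lattice :: "nat \<Rightarrow> real vec set gorder" where
  "linial_lattice n = intersection_lattice (carrier_vec (2 * n + 2)) (linial_arrangement n)"

lemma finite_linial_arrangement: "finite (linial_arrangement n)"
proof (rule finite_subset)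
  show "linial_arrangement n \<subseteq> (\<lambda>(i, j). linial_hyperplane n i j) ` ({1..n + 1} \<times> {1..n + 1})"
    by (force simp: linial_arrangement_def)
qed simp

lemma bottom_linial_lattice: "\<bottom>\<^bsub>linial_lattice n\<^esub> = carrier_vec (2 * n + 2)"
proof -
  interpret partial_order "linial_lattice n"
    unfolding linial_lattice_def by (rule partial_order_intersection_lattice)
  have "0\<^sub>v (2 * n + 2) \<in> (carrier_vec (2 * n + 2) :: real vec set)"
    by simp
  then have "(carrier_vec (2 * n + 2) :: real vec set) \<noteq> {}"
    by blast
  then have "least (linial_lattice n) (carrier_vec (2 * n + 2)) (carrier (linial_lattice n))"
    by (auto simp: least_def linial_lattice_def intersection_lattice_def intro: exI[of _ "{}"])
  then show ?thesis
    unfolding Order.bottom_def by (metis someI least_unique)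
qed

lemma top_linial_lattice:
  "\<top>\<^bsub>linial_lattice n\<^esub> = carrier_vec (2 * n + 2) \<inter> \<Inter>(linial_arrangement n)"
proof -
  interpret partial_order "linial_lattice n"
    unfolding linial_lattice_def by (rule partial_order_intersection_lattice)
  let ?X = "carrier_vec (2 * n + 2) \<inter> \<Inter>(linial_arrangement n)"
  have "0\<^sub>v (2 * n + 2) \<in> ?X"
    by (auto simp: linial_arrangement_def linial_hyperplane_def)
  then have "?X \<noteq> {}"
    by blast
  then have "greatest (linial_lattice n) ?X (carrier (linial_lattice n))"
    by (auto simp: greatest_def linial_lattice_def intersection_lattice_def)
  then show ?thesis
    unfolding Order.top_def by (metis someI greatest_unique)
qed

definition D_perms :: "nat \<Rightarrow> (nat \<Rightarrow> nat) set" where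
  "D_perms m = {\<sigma>. \<sigma> permutes {1..m} \<and>
     (\<forall>i \<in> {1..m}. (odd i \<longrightarrow> i \<le> \<sigma> i) \<and> (even i \<longrightarrow> i \<ge> \<sigma> i))}"

definition D_cycles :: "nat \<Rightarrow> (nat \<Rightarrow> nat) set" where
  "D_cycles m = {\<sigma> \<in> D_perms m. cyclic_on \<sigma> {1..m}}"

definition Dumont_perms :: "nat \<Rightarrow> (nat \<Rightarrow> nat) set" where
  "Dumont_perms N = {\<sigma>. \<sigma> permutes {1..2 * N} \<and>
     (\<forall>i \<in> {1..N}. 2 * i > \<sigma> (2 * i) \<and> 2 * i - 1 \<le> \<sigma> (2 * i - 1))}"

text \<open>The Genocchi numbers \<open>g\<^sub>n\<close> are only meant for \<open>n \<ge> 1\<close>; \<open>g\<^sub>n\<close> counts the Dumont permutations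
  of \<open>{1, \<dots>, 2n - 2}\<close>, i.e. \<open>Dumont_perms N\<close> with \<open>N = n - 1\<close>.\<close>

definition genocchi :: "nat \<Rightarrow> nat" where
  "genocchi n = card (Dumont_perms (n - 1))"

lemma genocchi_1: "genocchi 1 = 1"
  by (simp add: genocchi_def Dumont_perms_def)

end

theory Submission
  imports Defs "HOL-Computational_Algebra.Polynomial"
begin

text \<open>
  In the variables \<open>a\<^sub>i = x\<^sub>i - y\<^sub>i\<close> and \<open>b\<^sub>j = x\<^sub>j\<close> the hyperplanes read \<open>a\<^sub>i = b\<^sub>j\<close> for \<open>i < j\<close>, so the
  arrangement is the graphic arrangement of a bipartite Ferrers graph and the Moebius number is the
  sum of \<open>(-1)\<^sup>|\<^sup>B\<^sup>|\<close> over the connected spanning edge sets \<open>B\<close>, i.e. the linear coefficient of the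
  chromatic polynomial. Colouring \<open>a\<^sub>1, b\<^sub>2, a\<^sub>2, b\<^sub>3, \<dots>\<close> in this order and recording only the number of
  colours used on the \<open>a\<^sub>i\<close> yields a recursion for that polynomial. At \<open>0\<close> the same recursion counts
  Dumont permutations by inclusion-exclusion on the conditions \<open>\<sigma> p < p\<close>. Cyclic D-permutations are
  related to Dumont permutations by a Foata type correspondence: inserting a new minimum changes the
  excedance set of a cyclic permutation and the weak excedance set of an arbitrary permutation in the
  same way.
\<close>

subsection \<open>Cyclic permutations and excedances\<close>

text \<open>An orbit is the smallest nonempty forward-invariant set containing its base point, so
  being one cycle amounts to having no proper invariant part. In this form the cycle structure can
  be followed through a splice without computing orbits.\<close>

lemma cyclic_on_iff_no_invariant_subset:
  assumes "p permutes S" "finite S" "S \<noteq> {}"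
  shows "cyclic_on p S \<longleftrightarrow> (\<forall>T \<subseteq> S. T \<noteq> {} \<and> p ` T \<subseteq> T \<longrightarrow> T = S)"
proof
  assume cyc: "cyclic_on p S"
  show "\<forall>T \<subseteq> S. T \<noteq> {} \<and> p ` T \<subseteq> T \<longrightarrow> T = S"
  proof (intro allI impI, elim conjE)
    fix T assume T: "T \<subseteq> S" "T \<noteq> {}" "p ` T \<subseteq> T"
    then obtain t where t: "t \<in> T"
      by blast
    have "y \<in> T" if "y \<in> orbit p t" for y
      using that t T(3) by induction auto
    moreover have "orbit p t = S"
      using cyc t T(1) orbit_cyclic_eq3 by fastforce
    ultimately show "T = S"
      using T(1) by blast
  qed
next
  assume inv: "\<forall>T \<subseteq> S. T \<noteq> {} \<and> p ` T \<subseteq> T \<longrightarrow> T = S"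
  obtain s where s: "s \<in> S"
    using assms(3) by blast
  have "orbit p s \<subseteq> S"
    using assms(1) s by (rule permutes_orbit_subset)
  moreover have "p ` orbit p s \<subseteq> orbit p s"
    by (auto intro: orbit.step)
  ultimately have "S = orbit p s"
    using inv orbit_nonempty[of p s] by blast
  with s show "cyclic_on p S"
    unfolding cyclic_on_def by blast
qed

text \<open>\<open>p \<circ> transpose x m\<close> splices \<open>m\<close> into the cycle of
  \<open>p\<close> right after \<open>x\<close>: \<open>x\<close> goes to \<open>m\<close> and
  \<open>m\<close> to \<open>p x\<close>. For \<open>x = m\<close> it leaves \<open>m\<close> as a
  fixed point.\<close>

lemma permutes_insert_transpose:
  assumes "p permutes S" "x \<in> insert m S"
  shows "p \<circ> transpose x m permutes insert m S"
  by (rule permutes_compose[OF permutes_swap_id permutes_imp_permutes_insert]) (use assms in auto)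

text \<open>Splicing \<open>m\<close> in behind \<open>x\<close> neither merges nor splits cycles:
  invariant sets on the two sides match by adding or removing \<open>m\<close>.\<close>

lemma cyclic_on_insert_iff:
  assumes p: "p permutes S" and fin: "finite S" and x: "x \<in> S" and m: "m \<notin> S"
  shows "cyclic_on (p \<circ> transpose x m) (insert m S) \<longleftrightarrow> cyclic_on p S"
proof -
  define q where "q = p \<circ> transpose x m"
  have q: "q permutes insert m S"
    unfolding q_def using p x by (intro permutes_insert_transpose) auto
  have qx: "q x = m" and qm: "q m = p x" and qy: "\<And>y. y \<noteq> x \<Longrightarrow> y \<noteq> m \<Longrightarrow> q y = p y"
    using p m by (auto simp: q_def permutes_not_in)
  have pS: "p y \<in> S" if "y \<in> S" for y
    using p that by (simp add: permutes_in_image)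
  note iffs = cyclic_on_iff_no_invariant_subset[OF q] cyclic_on_iff_no_invariant_subset[OF p]
  have "cyclic_on q (insert m S) \<longleftrightarrow> cyclic_on p S"
  proof
    assume "cyclic_on q (insert m S)"
    then have inv: "T = insert m S" if "T \<subseteq> insert m S" "T \<noteq> {}" "q ` T \<subseteq> T" for T
      using that fin iffs(1) by blast
    have "T = S" if T: "T \<subseteq> S" "T \<noteq> {}" "p ` T \<subseteq> T" for T
    \<comment> \<open>If \<open>x\<close> lies in \<open>T\<close>, the enlarged set
      \<open>insert m T\<close> is \<open>q\<close>-invariant. Otherwise \<open>q\<close> and
      \<open>p\<close> agree on \<open>T\<close>, and the invariance of \<open>T\<close> itself
      would force \<open>m\<close> into \<open>S\<close>.\<close>
    proof (cases "x \<in> T")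
      case True
      have "q y \<in> insert m T" if "y \<in> insert m T" for y
        using that qx qm qy[of y] True T(3) by (cases "y = x"; cases "y = m") auto
      then have "insert m T = insert m S"
        using T(1) by (intro inv) auto
      moreover have "m \<notin> T"
        using m T(1) by blast
      ultimately show ?thesis
        using insert_ident[of m T S] m by blast
    next
      case False
      have "q y \<in> T" if "y \<in> T" for y
        using that qy[of y] False T m by auto
      then have "T = insert m S"
        using T(1,2) by (intro inv) auto
      then show ?thesis
        using m T(1) by blast
    qed
    then show "cyclic_on p S"
      using iffs(2) fin x by blast
  next
    assume "cyclic_on p S"
    then have inv: "T = S" if "T \<subseteq> S" "T \<noteq> {}" "p ` T \<subseteq> T" for T
      using that fin iffs(2) by blast
    have "T = insert m S" if T: "T \<subseteq> insert m S" "T \<noteq> {}" "q ` T \<subseteq> T" for T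
    proof -
      have px: "p x \<in> T" if "m \<in> T"
        using that qm T(3) by force
      have mT: "m \<in> T" if "x \<in> T"
        using that qx T(3) by force
      \<comment> \<open>Deleting \<open>m\<close> keeps invariance: the step from \<open>x\<close>
        to \<open>p x\<close> passes through \<open>m\<close> under \<open>q\<close>, so
        \<open>p x\<close> is still in \<open>T\<close>.\<close>
      have "p y \<in> T - {m}" if "y \<in> T - {m}" for y
      proof (cases "y = x")
        case True
        then show ?thesis
          using that px mT pS[OF x] m by auto
      next
        case False
        then show ?thesis
          using that qy[of y] T pS[of y] m by fastforce
      qed
      moreover have "T - {m} \<noteq> {}"
        using px pS[OF x] m T(2) by blast
      ultimately have "T - {m} = S"
        using T(1) by (intro inv) auto
      then show ?thesis
        using mT x by blast
    qed
    then show "cyclic_on q (insert m S)"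
      using iffs(1) fin by blast
  qed
  then show ?thesis
    by (simp add: q_def)
qed

text \<open>The splice can be undone: \<open>x\<close> is recovered as the preimage of
  \<open>m\<close>, and composing with the same transposition again removes
  \<open>m\<close>.\<close>

lemma bij_betw_permutes_insert:
  assumes "m \<notin> S"
  shows "bij_betw (\<lambda>(p, x). p \<circ> transpose x m)
           ({p. p permutes S} \<times> insert m S) {q. q permutes insert m S}"
proof (rule bij_betwI[where g = "\<lambda>q. (q \<circ> transpose (inv_into UNIV q m) m, inv_into UNIV q m)"])
  show "(\<lambda>(p, x). p \<circ> transpose x m) \<in> {p. p permutes S} \<times> insert m S \<rightarrow> {q. q permutes insert m S}"
    by (auto intro: permutes_insert_transpose)
next
  have "q \<circ> transpose (inv_into UNIV q m) m permutes S" if q: "q permutes insert m S" for q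
  proof (rule permutes_superset[where S = "insert m S"])
    show "q \<circ> transpose (inv_into UNIV q m) m permutes insert m S"
      using q permutes_in_image[OF permutes_inv[OF q]]
      by (intro permutes_compose permutes_swap_id) auto
  qed (use q in \<open>auto simp: permutes_inverses\<close>)
  moreover have "inv_into UNIV q m \<in> insert m S" if "q permutes insert m S" for q
    using permutes_in_image[OF permutes_inv[OF that]] by auto
  ultimately show "(\<lambda>q. (q \<circ> transpose (inv_into UNIV q m) m, inv_into UNIV q m))
      \<in> {q. q permutes insert m S} \<rightarrow> {p. p permutes S} \<times> insert m S"
    by auto
next
  fix px assume "px \<in> {p. p permutes S} \<times> insert m S"
  then obtain p x where px: "px = (p, x)" "p permutes S" "x \<in> insert m S"
    by auto
  have "inv_into UNIV (p \<circ> transpose x m) m = x"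
  proof (rule inv_f_eq)
    show "inj (p \<circ> transpose x m)"
      by (rule permutes_inj[OF permutes_insert_transpose[OF px(2,3)]])
    show "(p \<circ> transpose x m) x = m"
      using px(2) assms by (auto simp: permutes_not_in)
  qed
  then show "(\<lambda>q. (q \<circ> transpose (inv_into UNIV q m) m, inv_into UNIV q m)) ((\<lambda>(p, x). p \<circ> transpose x m) px) = px"
    using px by (simp add: o_assoc[symmetric])
qed (auto simp: o_assoc[symmetric])

text \<open>The same splice for single cycles. Only \<open>x = m\<close> drops out, since it would
  make \<open>{m}\<close> a proper invariant set.\<close>

lemma bij_betw_cyclic_insert:
  assumes fin: "finite S" and m: "m \<notin> S" and "S \<noteq> {}"
  shows "bij_betw (\<lambda>(p, x). p \<circ> transpose x m)
           ({p. p permutes S \<and> cyclic_on p S} \<times> S)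
           {q. q permutes insert m S \<and> cyclic_on q (insert m S)}"
  (is "bij_betw ?f ?A ?B")
proof -
  have img: "?f ` ?A = ?B"
  proof (rule equalityI; rule subsetI)
    fix q assume "q \<in> ?f ` ?A"
    then obtain p x where px: "p permutes S" "cyclic_on p S" "x \<in> S" "q = p \<circ> transpose x m"
      by auto
    then have "q permutes insert m S"
      by (auto intro: permutes_insert_transpose)
    then show "q \<in> ?B"
      using cyclic_on_insert_iff[OF px(1) fin px(3) m] px by simp
  next
    fix q assume q: "q \<in> ?B"
    then have "q \<in> ?f ` ({p. p permutes S} \<times> insert m S)"
      using bij_betw_imp_surj_on[OF bij_betw_permutes_insert[OF m]] by blast
    then obtain p x where px: "p permutes S" "x \<in> insert m S" "q = p \<circ> transpose x m"
      by auto
    have "x \<noteq> m"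
    proof
      assume "x = m"
      then have "q m = m"
        using px m by (simp add: permutes_not_in)
      moreover have "\<forall>T \<subseteq> insert m S. T \<noteq> {} \<and> q ` T \<subseteq> T \<longrightarrow> T = insert m S"
        using q fin by (subst cyclic_on_iff_no_invariant_subset[symmetric]) auto
      ultimately have "{m} = insert m S"
        by auto
      then show False
        using m \<open>S \<noteq> {}\<close> by blast
    qed
    then show "q \<in> ?f ` ?A"
      using px q cyclic_on_insert_iff[OF px(1) fin _ m] by auto
  qed
  have "inj_on ?f ?A"
    using bij_betw_imp_inj_on[OF bij_betw_permutes_insert[OF m]] by (rule inj_on_subset) auto
  with img show ?thesis
    unfolding bij_betw_def by blast
qed

text \<open>The Foata type correspondence, by induction on a new minimum \<open>m\<close>. Splicing
  \<open>m\<close> behind \<open>x\<close> makes \<open>m\<close> an excedance and destroys a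
  possible excedance at \<open>x\<close>, both for cycles on \<open>insert z S\<close> and for
  permutations of \<open>S\<close>. The weight \<open>F\<close> is arbitrary because the induction
  hypothesis is applied to a modified weight.\<close>

lemma sum_cyclic_excedances:
  fixes F :: "'a::linorder set \<Rightarrow> 'b::comm_monoid_add"
  assumes "finite S" "\<And>x. x \<in> S \<Longrightarrow> x < z"
  shows "(\<Sum>\<sigma> | \<sigma> permutes insert z S \<and> cyclic_on \<sigma> (insert z S). F {x \<in> S. x < \<sigma> x})
       = (\<Sum>\<sigma> | \<sigma> permutes S. F {x \<in> S. x \<le> \<sigma> x})"
  using assms
proof (induction S arbitrary: F rule: finite_linorder_min_induct)
  case empty
  have "cyclic_on id {z}"
    by (subst cyclic_on_iff_no_invariant_subset) auto
  then have "{\<sigma>. \<sigma> permutes {z} \<and> cyclic_on \<sigma> {z}} = {id}"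
    by auto
  then show ?case
    by simp
next
  case (insert m S)
  let ?Z = "insert z S"
  \<comment> \<open>Total weight of all splices into a permutation with excedance set
    \<open>D\<close>. The first summand is the one splice that deletes nothing: \<open>x = z\<close>
    for cycles, \<open>x = m\<close> for arbitrary permutations.\<close>
  define F' where "F' D = F (insert m D) + (\<Sum>x\<in>S. F (insert m (D - {x})))" for D
  have m: "m \<notin> ?Z" "m \<notin> S" "z \<notin> S" and fin: "finite ?Z"
    using insert by fastforce+
  have lt: "m < x" if "x \<in> ?Z" for x
    using that insert by auto
  have "(\<Sum>\<sigma> | \<sigma> permutes insert z (insert m S) \<and> cyclic_on \<sigma> (insert z (insert m S)).
          F {x \<in> insert m S. x < \<sigma> x})
      = (\<Sum>(p, x) \<in> {p. p permutes ?Z \<and> cyclic_on p ?Z} \<times> ?Z.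
          F {y \<in> insert m S. y < (p \<circ> transpose x m) y})"
    using sum.reindex_bij_betw[OF bij_betw_cyclic_insert[OF fin m(1)],
        of "\<lambda>\<sigma>. F {x \<in> insert m S. x < \<sigma> x}"]
    by (simp add: insert_commute[of z m] case_prod_unfold)
  also have "\<dots> = (\<Sum>p | p permutes ?Z \<and> cyclic_on p ?Z. F' {y \<in> S. y < p y})"
  proof (subst sum.cartesian_product[symmetric], rule sum.cong[OF refl])
    fix p assume p: "p \<in> {p. p permutes ?Z \<and> cyclic_on p ?Z}"
    have pZ: "p x \<in> ?Z" if "x \<in> ?Z" for x
      using p that permutes_in_image[of p ?Z x] by blast
    have pm: "p m = m"
      using p m by (auto simp: permutes_not_in)
    have "{y \<in> insert m S. y < (p \<circ> transpose x m) y} = insert m ({y \<in> S. y < p y} - {x})"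
      if x: "x \<in> ?Z" for x
      using x lt pm lt[OF pZ[OF x]] m by (auto simp: transpose_def less_le_not_le)
    then have "(\<Sum>x\<in>?Z. F {y \<in> insert m S. y < (p \<circ> transpose x m) y})
        = (\<Sum>x\<in>?Z. F (insert m ({y \<in> S. y < p y} - {x})))"
      by (intro sum.cong) auto
    \<comment> \<open>For \<open>x = z\<close> nothing is removed, as \<open>z\<close> is not in
      \<open>S\<close>.\<close>
    also have "\<dots> = F' {y \<in> S. y < p y}"
      using m(3) insert(1) by (simp add: F'_def)
    finally show "(\<Sum>x\<in>?Z. F {y \<in> insert m S. y < (p \<circ> transpose x m) y})
        = F' {y \<in> S. y < p y}" .
  qed
  also have "\<dots> = (\<Sum>p | p permutes S. F' {y \<in> S. y \<le> p y})"
    using insert by (intro insert.IH) auto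
  also have "\<dots> = (\<Sum>(p, x) \<in> {p. p permutes S} \<times> insert m S.
          F {y \<in> insert m S. y \<le> (p \<circ> transpose x m) y})"
  proof (subst sum.cartesian_product[symmetric], rule sum.cong[OF refl])
    fix p assume p: "p \<in> {p. p permutes S}"
    have pS: "p x \<in> S" if "x \<in> S" for x
      using p that permutes_in_image[of p S x] by blast
    have pm: "p m = m"
      using p m by (auto simp: permutes_not_in)
    have ltS: "m < x" if "x \<in> S" for x
      using lt that by auto
    have eq: "{y \<in> insert m S. y \<le> (p \<circ> transpose x m) y} = insert m ({y \<in> S. y \<le> p y} - {x})"
      if x: "x \<in> S" for x
      using x pm ltS ltS[OF pS[OF x]] m by (auto simp: transpose_def less_le_not_le)
    \<comment> \<open>For \<open>x = m\<close> the new element is fixed; it still counts because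
      excedances are weak on this side.\<close>
    have eqm: "{y \<in> insert m S. y \<le> (p \<circ> transpose m m) y} = insert m {y \<in> S. y \<le> p y}"
      using pm by auto
    have "F' {y \<in> S. y \<le> p y} = F (insert m {y \<in> S. y \<le> p y})
        + (\<Sum>x\<in>S. F {y \<in> insert m S. y \<le> (p \<circ> transpose x m) y})"
      using eq by (auto simp: F'_def intro!: arg_cong2[where f = "(+)"] sum.cong)
    then show "F' {y \<in> S. y \<le> p y}
        = (\<Sum>x\<in>insert m S. F {y \<in> insert m S. y \<le> (p \<circ> transpose x m) y})"
      using eqm by (subst sum.insert[OF insert(1) m(2)]) (simp only:)
  qed
  also have "\<dots> = (\<Sum>\<sigma> | \<sigma> permutes insert m S. F {y \<in> insert m S. y \<le> \<sigma> y})"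
    using sum.reindex_bij_betw[OF bij_betw_permutes_insert[OF m(2)],
        of "\<lambda>\<sigma>. F {y \<in> insert m S. y \<le> \<sigma> y}"]
    by (simp add: case_prod_unfold)
  finally show ?case .
qed

lemma card_cyclic_excedances:
  fixes S D :: "'a::linorder set"
  assumes "finite S" "\<And>x. x \<in> S \<Longrightarrow> x < z"
  shows "card {\<sigma>. \<sigma> permutes insert z S \<and> cyclic_on \<sigma> (insert z S) \<and> {x \<in> S. x < \<sigma> x} = D}
       = card {\<sigma>. \<sigma> permutes S \<and> {x \<in> S. x \<le> \<sigma> x} = D}"
proof -
  have f1: "finite {\<sigma>. \<sigma> permutes insert z S \<and> cyclic_on \<sigma> (insert z S)}"
    using assms(1) by (intro finite_subset[OF _ finite_permutations[of "insert z S"]]) auto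
  have f2: "finite {\<sigma>. \<sigma> permutes S}"
    using assms(1) by (rule finite_permutations)
  have count: "(\<Sum>\<sigma> | P \<sigma>. of_bool (Q \<sigma>)) = card {\<sigma>. P \<sigma> \<and> Q \<sigma>}"
    if "finite {\<sigma>. P \<sigma>}" for P Q :: "('a \<Rightarrow> 'a) \<Rightarrow> bool"
    using that by (simp add: of_bool_def sum.If_cases Int_def)
  show ?thesis
    using sum_cyclic_excedances[OF assms, of "\<lambda>E. of_bool (E = D) :: nat"]
    unfolding count[OF f1] count[OF f2] by (simp only: conj_assoc)
qed

section \<open>Cyclic D-permutations and Dumont permutations\<close>

lemma Dumont_perms_eq:
  "Dumont_perms N = {\<sigma>. \<sigma> permutes {1..2 * N} \<and> (\<forall>p \<in> {1..2 * N}. odd p \<longleftrightarrow> p \<le> \<sigma> p)}"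
proof -
  have "(\<forall>i \<in> {1..N}. \<sigma> (2 * i) < 2 * i \<and> 2 * i - 1 \<le> \<sigma> (2 * i - 1))
      \<longleftrightarrow> (\<forall>x \<in> {1..2 * N}. odd x \<longleftrightarrow> x \<le> \<sigma> x)" (is "?L \<longleftrightarrow> ?R") for \<sigma> :: "nat \<Rightarrow> nat"
  proof
    assume L: ?L
    show ?R
    proof
      fix x assume x: "x \<in> {1..2 * N}"
      show "odd x \<longleftrightarrow> x \<le> \<sigma> x"
      proof (cases "even x")
        case True
        then obtain i where "x = 2 * i" by blast
        then show ?thesis using L x by force
      next
        case False
        then obtain i where "x = 2 * i + 1" by (blast elim: oddE)
        then show ?thesis using L[rule_format, of "Suc i"] x by force
      qed
    qed
  next
    assume R: ?R
    show ?L
    proof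
      fix i assume "i \<in> {1..N}"
      then have "2 * i \<in> {1..2 * N}" "2 * i - 1 \<in> {1..2 * N}" "odd (2 * i - 1)"
        by auto
      then show "\<sigma> (2 * i) < 2 * i \<and> 2 * i - 1 \<le> \<sigma> (2 * i - 1)"
        using R[rule_format, of "2 * i"] R[rule_format, of "2 * i - 1"] by simp
    qed
  qed
  then show ?thesis
    unfolding Dumont_perms_def by blast
qed

text \<open>Apply the correspondence with \<open>z = 2 * n\<close> and the odd numbers as excedance
  set. It leads to permutations of \<open>{1..2 * n - 1}\<close> whose weak excedances are the odd
  positions; these fix the maximum and restrict to Dumont permutations of
  \<open>{1..2 * (n - 1)}\<close>.\<close>

lemma card_D_cycles:
  assumes "n \<ge> 1"
  shows "card (D_cycles (2 * n)) = genocchi n"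
proof -
  define S where "S = {1..2 * n - 1}"
  define D where "D = {x \<in> S. odd x}"
  have ins: "insert (2 * n) S = {1..2 * n}"
    using assms by (auto simp: S_def)
  have "D_cycles (2 * n) = {\<sigma>. \<sigma> permutes insert (2 * n) S \<and> cyclic_on \<sigma> (insert (2 * n) S)
      \<and> {x \<in> S. x < \<sigma> x} = D}" (is "_ = ?C")
  proof (rule Set.set_eqI)
    fix \<sigma>
    show "\<sigma> \<in> D_cycles (2 * n) \<longleftrightarrow> \<sigma> \<in> ?C"
    proof (cases "\<sigma> permutes {1..2 * n} \<and> cyclic_on \<sigma> {1..2 * n}")
      case False
      then show ?thesis
        unfolding ins by (auto simp: D_cycles_def D_perms_def)
    next
      case True
      \<comment> \<open>A single cycle on \<open>2 * n\<close> points, hence on more than one, has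
        no fixed point. The weak inequalities of a D-permutation therefore become strict.\<close>
      have nofix: "\<sigma> i \<noteq> i" if "i \<in> {1..2 * n}" for i
      proof
        assume "\<sigma> i = i"
        moreover have "\<forall>T \<subseteq> {1..2 * n}. T \<noteq> {} \<and> \<sigma> ` T \<subseteq> T \<longrightarrow> T = {1..2 * n}"
          using True assms by (subst cyclic_on_iff_no_invariant_subset[symmetric]) auto
        ultimately have "{i} = {1..2 * n}"
          using that by (elim allE[of _ "{i}"]) simp
        then have "card {1..2 * n} = 1"
          by (metis is_singletonI is_singleton_altdef)
        then show False
          by simp
      qed
      have le: "\<sigma> (2 * n) \<le> 2 * n"
        using True assms permutes_in_image[of \<sigma> "{1..2 * n}" "2 * n"] by auto
      have "(odd i \<longrightarrow> i \<le> \<sigma> i) \<and> (even i \<longrightarrow> \<sigma> i \<le> i) \<longleftrightarrow> (odd i \<longleftrightarrow> i < \<sigma> i)"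
        if "i \<in> {1..2 * n}" for i
        using nofix[OF that] by (cases "odd i") auto
      then have "(\<forall>i \<in> {1..2 * n}. (odd i \<longrightarrow> i \<le> \<sigma> i) \<and> (even i \<longrightarrow> \<sigma> i \<le> i))
          \<longleftrightarrow> (\<forall>i \<in> {1..2 * n}. odd i \<longleftrightarrow> i < \<sigma> i)"
        by blast
      \<comment> \<open>The position \<open>2 * n\<close> is even and maximal, so its condition
        holds automatically.\<close>
      also have "\<dots> \<longleftrightarrow> (\<forall>i \<in> S. odd i \<longleftrightarrow> i < \<sigma> i)"
        using le by (subst ins[symmetric]) (simp add: not_less)
      also have "\<dots> \<longleftrightarrow> {x \<in> S. x < \<sigma> x} = D"
        unfolding D_def by blast
      finally show ?thesis
        using True unfolding ins D_cycles_def D_perms_def by blast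
    qed
  qed
  also have "card \<dots> = card {\<sigma>. \<sigma> permutes S \<and> {x \<in> S. x \<le> \<sigma> x} = D}"
    by (rule card_cyclic_excedances) (use assms in \<open>auto simp: S_def\<close>)
  also have "{\<sigma>. \<sigma> permutes S \<and> {x \<in> S. x \<le> \<sigma> x} = D} = Dumont_perms (n - 1)" (is "?P = _")
  proof (rule Set.set_eqI)
    fix \<sigma>
    have S': "S = insert (2 * n - 1) {1..2 * (n - 1)}"
      using assms by (auto simp: S_def)
    have P: "\<sigma> \<in> ?P \<longleftrightarrow> \<sigma> permutes S \<and> (\<forall>x \<in> S. odd x \<longleftrightarrow> x \<le> \<sigma> x)"
      unfolding D_def by blast
    show "\<sigma> \<in> ?P \<longleftrightarrow> \<sigma> \<in> Dumont_perms (n - 1)"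
    proof
      assume "\<sigma> \<in> ?P"
      then have p: "\<sigma> permutes S" and o: "\<forall>x \<in> S. odd x \<longleftrightarrow> x \<le> \<sigma> x"
        unfolding P by simp_all
      have top: "2 * n - 1 \<in> S" "odd (2 * n - 1)"
        using assms by (auto simp: S_def)
      have "2 * n - 1 \<le> \<sigma> (2 * n - 1)"
        using bspec[OF o top(1)] top(2) by (rule iffD1)
      moreover have "\<sigma> (2 * n - 1) \<in> S"
        using top(1) by (subst permutes_in_image[OF p])
      ultimately have "\<sigma> (2 * n - 1) = 2 * n - 1"
        by (auto simp: S_def)
      then have "\<sigma> permutes {1..2 * (n - 1)}"
        by (intro permutes_superset[OF p]) (auto simp: S')
      then show "\<sigma> \<in> Dumont_perms (n - 1)"
        using o by (simp add: Dumont_perms_eq S')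
    next
      assume "\<sigma> \<in> Dumont_perms (n - 1)"
      then have p: "\<sigma> permutes {1..2 * (n - 1)}" and o: "\<forall>x \<in> {1..2 * (n - 1)}. odd x \<longleftrightarrow> x \<le> \<sigma> x"
        by (auto simp: Dumont_perms_eq)
      have "\<sigma> (2 * n - 1) = 2 * n - 1"
        using p assms by (intro permutes_not_in[OF p]) auto
      moreover have "odd (2 * n - 1)"
        using assms by simp
      ultimately have "\<forall>x \<in> S. odd x \<longleftrightarrow> x \<le> \<sigma> x"
        unfolding S' using o by simp
      moreover have "\<sigma> permutes S"
        unfolding S' using p by (rule permutes_imp_permutes_insert)
      ultimately show "\<sigma> \<in> ?P"
        by (intro iffD2[OF P] conjI)
    qed
  qed
  finally show ?thesis
    by (simp add: genocchi_def)
qed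

subsection \<open>Counting Dumont permutations\<close>

text \<open>The number of ways, in terms of the number of available colours, to colour \<open>m\<close> further pairs
  \<open>a\<^sub>i, b\<^sub>i\<^sub>+\<^sub>1\<close> when \<open>k\<close> colours already occur among the earlier \<open>a\<close>'s.\<close>

primrec ferrers_poly :: "nat \<Rightarrow> nat \<Rightarrow> int poly" where
  "ferrers_poly 0 k = 1"
| "ferrers_poly (Suc m) k = [:- int k, 1:] *
     (of_nat k * ferrers_poly m k + [:- int (Suc k), 1:] * ferrers_poly m (Suc k))"

text \<open>With \<open>M = i + k\<close>, the last \<open>k\<close> positions are the ones left unconstrained by inclusion-exclusion.\<close>

definition Dumont_prefix :: "nat \<Rightarrow> nat \<Rightarrow> (nat \<Rightarrow> nat) set" where
  "Dumont_prefix i M = {\<sigma>. \<sigma> permutes {1..M} \<and> (\<forall>p \<in> {1..i}. odd p \<longleftrightarrow> p \<le> \<sigma> p)}"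

lemma finite_Dumont_prefix: "finite (Dumont_prefix i M)"
  by (rule finite_subset[OF _ finite_permutations[of "{1..M}"]]) (auto simp: Dumont_prefix_def)

lemma Dumont_perms_eq_prefix: "Dumont_perms N = Dumont_prefix (2 * N) (2 * N)"
  by (simp add: Dumont_perms_eq Dumont_prefix_def)

text \<open>Once position \<open>j\<close> is known to take value \<open>b\<close>, both can be
  moved to the top index and deleted. The constrained positions are untouched because
  \<open>j > i\<close>, and exchanging two values above \<open>i\<close> does not alter a comparison
  with some \<open>p \<le> i\<close>.\<close>

lemma bij_betw_Dumont_prefix_fix_value:
  assumes j: "i < j" "j \<le> Suc M" and b: "i < b" "b \<le> Suc M"
  shows "bij_betw (\<lambda>\<sigma>. transpose b (Suc M) \<circ> \<sigma> \<circ> transpose j (Suc M))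
           {\<sigma> \<in> Dumont_prefix i (Suc M). \<sigma> j = b} (Dumont_prefix i M)"
proof -
  let ?t = "\<lambda>a. transpose a (Suc M)"
  have perm: "?t a permutes {1..Suc M}" if "i < a" "a \<le> Suc M" for a
    using that by (intro permutes_swap_id) auto
  have cond: "(?t b \<circ> \<sigma> \<circ> ?t j) p \<ge> p \<longleftrightarrow> \<sigma> p \<ge> p" if "p \<in> {1..i}" for \<sigma> p
    using that j b by (auto simp: transpose_def)
  show ?thesis
  proof (rule bij_betwI[where g = "\<lambda>\<tau>. ?t b \<circ> \<tau> \<circ> ?t j"])
    show "(\<lambda>\<sigma>. ?t b \<circ> \<sigma> \<circ> ?t j) \<in> {\<sigma> \<in> Dumont_prefix i (Suc M). \<sigma> j = b} \<rightarrow> Dumont_prefix i M"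
    proof
      fix \<sigma> assume "\<sigma> \<in> {\<sigma> \<in> Dumont_prefix i (Suc M). \<sigma> j = b}"
      then have \<sigma>: "\<sigma> permutes {1..Suc M}" "\<sigma> j = b" "\<forall>p \<in> {1..i}. odd p \<longleftrightarrow> p \<le> \<sigma> p"
        by (auto simp: Dumont_prefix_def)
      have "?t b \<circ> \<sigma> \<circ> ?t j permutes {1..Suc M}"
        by (intro permutes_compose perm j b \<sigma>(1))
      then have "?t b \<circ> \<sigma> \<circ> ?t j permutes {1..M}"
      proof (rule permutes_superset)
        fix x assume "x \<in> {1..Suc M} - {1..M}"
        then have "x = Suc M"
          by auto
        then show "(?t b \<circ> \<sigma> \<circ> ?t j) x = x"
          by (simp add: \<sigma>(2))
      qed
      then show "?t b \<circ> \<sigma> \<circ> ?t j \<in> Dumont_prefix i M"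
        using \<sigma>(3) cond by (simp add: Dumont_prefix_def del: o_apply)
    qed
  next
    show "(\<lambda>\<tau>. ?t b \<circ> \<tau> \<circ> ?t j) \<in> Dumont_prefix i M \<rightarrow> {\<sigma> \<in> Dumont_prefix i (Suc M). \<sigma> j = b}"
    proof
      fix \<tau> assume "\<tau> \<in> Dumont_prefix i M"
      then have \<tau>: "\<tau> permutes {1..M}" "\<forall>p \<in> {1..i}. odd p \<longleftrightarrow> p \<le> \<tau> p"
        by (auto simp: Dumont_prefix_def)
      have "\<tau> permutes {1..Suc M}"
        using \<tau>(1) by (rule permutes_subset) auto
      then have "?t b \<circ> \<tau> \<circ> ?t j permutes {1..Suc M}"
        by (intro permutes_compose perm j b)
      moreover have "(?t b \<circ> \<tau> \<circ> ?t j) j = b"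
        using \<tau>(1) by (simp add: permutes_not_in)
      ultimately show "?t b \<circ> \<tau> \<circ> ?t j \<in> {\<sigma> \<in> Dumont_prefix i (Suc M). \<sigma> j = b}"
        using \<tau>(2) cond by (simp add: Dumont_prefix_def del: o_apply)
    qed
  qed (simp_all add: fun_eq_iff)
qed

text \<open>The value at \<open>Suc i\<close> is one of the \<open>k\<close> numbers from
  \<open>Suc i\<close> to \<open>i + k\<close>; deleting the position together with its value leaves
  the same count each time.\<close>

lemma card_Dumont_prefix_weak_excedance:
  assumes "k > 0"
  shows "card {\<sigma> \<in> Dumont_prefix i (i + k). Suc i \<le> \<sigma> (Suc i)}
       = k * card (Dumont_prefix i (i + k - 1))"
proof -
  obtain M where M: "i + k = Suc M"
    using assms by (cases "i + k") auto
  have "\<sigma> (Suc i) \<le> Suc M" if "\<sigma> \<in> Dumont_prefix i (Suc M)" for \<sigma>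
    using that permutes_in_image[of \<sigma> "{1..Suc M}" "Suc i"] M assms by (auto simp: Dumont_prefix_def)
  then have "{\<sigma> \<in> Dumont_prefix i (Suc M). Suc i \<le> \<sigma> (Suc i)}
      = (\<Union>b\<in>{Suc i..Suc M}. {\<sigma> \<in> Dumont_prefix i (Suc M). \<sigma> (Suc i) = b})"
    by auto
  then have "card {\<sigma> \<in> Dumont_prefix i (Suc M). Suc i \<le> \<sigma> (Suc i)}
      = (\<Sum>b\<in>{Suc i..Suc M}. card {\<sigma> \<in> Dumont_prefix i (Suc M). \<sigma> (Suc i) = b})"
    by (simp only:) (rule card_UN_disjoint, auto simp: finite_Dumont_prefix)
  also have "\<dots> = (\<Sum>b\<in>{Suc i..Suc M}. card (Dumont_prefix i M))"
    using M assms by (intro sum.cong refl bij_betw_same_card[OF bij_betw_Dumont_prefix_fix_value]) auto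
  also have "\<dots> = (Suc M - i) * card (Dumont_prefix i M)"
    by simp
  also have "Suc M - i = k"
    using M by simp
  finally show ?thesis
    using M by simp
qed

lemma card_Dumont_prefix_odd:
  assumes "even i"
  shows "card (Dumont_prefix (Suc i) (Suc i + k)) = Suc k * card (Dumont_prefix i (i + k))"
proof -
  have "Dumont_prefix (Suc i) (Suc i + k) = {\<sigma> \<in> Dumont_prefix i (i + Suc k). Suc i \<le> \<sigma> (Suc i)}"
    using assms by (auto simp: Dumont_prefix_def atLeastAtMostSuc_conv)
  then show ?thesis
    using card_Dumont_prefix_weak_excedance[of "Suc k" i] by simp
qed

text \<open>The inclusion-exclusion step: \<open>Suc i\<close> is now even, so the permutations with
  a weak excedance there are subtracted.\<close>

lemma card_Dumont_prefix_even:
  assumes "odd i"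
  shows "int (card (Dumont_prefix (Suc i) (Suc i + k)))
       = int (card (Dumont_prefix i (i + Suc k))) - int (Suc k) * int (card (Dumont_prefix i (i + k)))"
proof -
  let ?A = "Dumont_prefix i (i + Suc k)" and ?B = "{\<sigma> \<in> Dumont_prefix i (i + Suc k). Suc i \<le> \<sigma> (Suc i)}"
  have "Dumont_prefix (Suc i) (Suc i + k) = ?A - ?B"
    using assms by (auto simp: Dumont_prefix_def atLeastAtMostSuc_conv)
  moreover have "card (?A - ?B) = card ?A - card ?B" "card ?B \<le> card ?A"
    by (auto intro: card_Diff_subset card_mono finite_subset[OF _ finite_Dumont_prefix])
  ultimately show ?thesis
    using card_Dumont_prefix_weak_excedance[of "Suc k" i] by (simp add: of_nat_diff algebra_simps)
qed

text \<open>One odd and one even position together reproduce the recursion of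
  \<open>ferrers_poly\<close> at \<open>0\<close>. The factor \<open>fact k\<close> is the count for
  \<open>m = 0\<close>, where nothing is constrained, and absorbs the change of \<open>k\<close> in
  the recursion.\<close>

lemma card_Dumont_prefix_double:
  "int (card (Dumont_prefix (2 * m) (2 * m + k))) = fact k * poly (ferrers_poly m (Suc k)) 0"
proof (induction m arbitrary: k)
  case 0
  have "Dumont_prefix 0 k = {\<sigma>. \<sigma> permutes {1..k}}"
    by (auto simp: Dumont_prefix_def)
  then show ?case
    by (simp add: card_permutations of_nat_fact)
next
  case (Suc m)
  have odd: "int (card (Dumont_prefix (Suc (2 * m)) (Suc (2 * m) + l)))
      = int (Suc l) * int (card (Dumont_prefix (2 * m) (2 * m + l)))" for l
    by (subst card_Dumont_prefix_odd) (simp_all only: of_nat_mult even_mult_iff even_numeral simp_thms)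
  have "int (card (Dumont_prefix (2 * Suc m) (2 * Suc m + k)))
      = int (card (Dumont_prefix (Suc (2 * m)) (Suc (2 * m) + Suc k)))
        - int (Suc k) * int (card (Dumont_prefix (Suc (2 * m)) (Suc (2 * m) + k)))"
    using card_Dumont_prefix_even[of "Suc (2 * m)" k] by simp
  also have "\<dots> = int (Suc (Suc k)) * (fact (Suc k) * poly (ferrers_poly m (Suc (Suc k))) 0)
        - int (Suc k) * (int (Suc k) * (fact k * poly (ferrers_poly m (Suc k)) 0))"
    unfolding odd Suc.IH ..
  also have "\<dots> = fact k * poly (ferrers_poly (Suc m) (Suc k)) 0"
    by (simp add: algebra_simps)
  finally show ?case .
qed

lemma genocchi_eq_ferrers_poly: "int (genocchi n) = poly (ferrers_poly (n - 1) 1) 0"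
  using card_Dumont_prefix_double[of "n - 1" 0] by (simp add: genocchi_def Dumont_perms_eq_prefix)

text \<open>For \<open>k = 0\<close> the recursion reads X * (X - 1) *
  \<open>ferrers_poly m 1\<close>, so the linear coefficient is minus the value of
  \<open>ferrers_poly m 1\<close> at \<open>0\<close>.\<close>

lemma coeff_ferrers_poly:
  assumes "n \<ge> 1"
  shows "coeff (ferrers_poly n 0) 1 = - int (genocchi n)"
proof -
  obtain m where n: "n = Suc m"
    using assms by (cases n) auto
  show ?thesis
    by (simp add: n genocchi_eq_ferrers_poly poly_0_coeff_0)
qed

text \<open>The first \<open>n\<close> of the a's are coloured explicitly by \<open>a\<close>, and
  the \<open>j\<close>-th factor counts the colours of b_{j+1} avoiding those of a_1, ..., a_j. The
  remaining \<open>m\<close> pairs are accounted for by the polynomial. Keeping \<open>m\<close>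
  general lets the induction on \<open>n\<close> hand over one pair at a time; \<open>m = 0\<close>
  gives the colouring count.\<close>

lemma sum_PiE_ferrers_poly:
  assumes "finite T"
  shows "(\<Sum>a \<in> {1..n} \<rightarrow>\<^sub>E T. (\<Prod>j=1..n. int (card T) - int (card (a ` {1..j})))
            * poly (ferrers_poly m (card (a ` {1..n}))) (int (card T)))
       = poly (ferrers_poly (n + m) 0) (int (card T))"
proof (induction n arbitrary: m)
  case 0
  then show ?case by simp
next
  case (Suc n)
  define t where "t = int (card T)"
  have ins: "{1..Suc n} = insert (Suc n) {1..n}"
    by auto
  have "(\<Sum>a \<in> {1..Suc n} \<rightarrow>\<^sub>E T. (\<Prod>j=1..Suc n. t - int (card (a ` {1..j})))
          * poly (ferrers_poly m (card (a ` {1..Suc n}))) t)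
      = (\<Sum>(c, a) \<in> T \<times> ({1..n} \<rightarrow>\<^sub>E T).
          (\<Prod>j=1..Suc n. t - int (card ((a(Suc n := c)) ` {1..j})))
          * poly (ferrers_poly m (card ((a(Suc n := c)) ` {1..Suc n}))) t)"
    unfolding ins PiE_insert_eq
    by (subst sum.reindex, rule inj_combinator, simp) (simp only: o_def case_prod_unfold)
  also have "\<dots> = (\<Sum>a \<in> {1..n} \<rightarrow>\<^sub>E T. \<Sum>c\<in>T.
          (\<Prod>j=1..n. t - int (card (a ` {1..j})))
          * ((t - int (card (insert c (a ` {1..n})))) * poly (ferrers_poly m (card (insert c (a ` {1..n})))) t))"
  proof (subst sum.swap, subst sum.cartesian_product, rule sum.cong[OF refl], clarify)
    fix c a assume "c \<in> T" "a \<in> {1..n} \<rightarrow>\<^sub>E T"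
    have low: "(a(Suc n := c)) ` {1..j} = a ` {1..j}" if "j \<le> n" for j
      using that by (intro image_cong) auto
    have top: "(a(Suc n := c)) ` {1..Suc n} = insert c (a ` {1..n})"
      unfolding ins using low[of n] by auto
    have split: "(\<Prod>j=1..Suc n. h j) = (\<Prod>j=1..n. h j) * h (Suc n)" for h :: "nat \<Rightarrow> int"
      by simp
    have prefix: "(\<Prod>j=1..n. t - int (card ((a(Suc n := c)) ` {1..j})))
        = (\<Prod>j=1..n. t - int (card (a ` {1..j})))"
      by (intro prod.cong refl) (simp only: low atLeastAtMost_iff)
    show "(\<Prod>j=1..Suc n. t - int (card ((a(Suc n := c)) ` {1..j})))
          * poly (ferrers_poly m (card ((a(Suc n := c)) ` {1..Suc n}))) t
        = (\<Prod>j=1..n. t - int (card (a ` {1..j})))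
          * ((t - int (card (insert c (a ` {1..n})))) * poly (ferrers_poly m (card (insert c (a ` {1..n})))) t)"
      unfolding split top prefix by (rule mult.assoc)
  qed
  also have "\<dots> = (\<Sum>a \<in> {1..n} \<rightarrow>\<^sub>E T. (\<Prod>j=1..n. t - int (card (a ` {1..j})))
          * poly (ferrers_poly (Suc m) (card (a ` {1..n}))) t)"
  proof (rule sum.cong[OF refl])
    fix a assume a: "a \<in> {1..n} \<rightarrow>\<^sub>E T"
    define U where "U = a ` {1..n}"
    have U: "U \<subseteq> T" "finite U"
      using a by (auto simp: U_def PiE_def)
    define G where "G k = (t - int k) * poly (ferrers_poly m k) t" for k
    \<comment> \<open>The colour of the next a is either old, leaving the number of used colours
      unchanged, or new, raising it by one. These are the two summands of the recursion.\<close>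
    have "(\<Sum>c\<in>T. G (card (insert c U))) = (\<Sum>c\<in>U. G (card (insert c U))) + (\<Sum>c\<in>T - U. G (card (insert c U)))"
      using U assms by (simp add: sum.subset_diff add.commute)
    also have "\<dots> = (\<Sum>c\<in>U. G (card U)) + (\<Sum>c\<in>T - U. G (Suc (card U)))"
      using U by (intro arg_cong2[where f = "(+)"] sum.cong) (auto simp: insert_absorb)
    also have "\<dots> = int (card U) * G (card U) + (t - int (card U)) * G (Suc (card U))"
      using U assms by (simp add: t_def card_Diff_subset of_nat_diff card_mono)
    also have "\<dots> = poly (ferrers_poly (Suc m) (card U)) t"
      by (simp add: G_def algebra_simps)
    finally have "(\<Sum>c\<in>T. G (card (insert c U))) = poly (ferrers_poly (Suc m) (card U)) t" .
    then show "(\<Sum>c\<in>T. (\<Prod>j=1..n. t - int (card (a ` {1..j})))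
          * ((t - int (card (insert c (a ` {1..n})))) * poly (ferrers_poly m (card (insert c (a ` {1..n})))) t))
        = (\<Prod>j=1..n. t - int (card (a ` {1..j}))) * poly (ferrers_poly (Suc m) (card (a ` {1..n}))) t"
      by (simp only: G_def U_def sum_distrib_left[symmetric])
  qed
  also have "\<dots> = poly (ferrers_poly (Suc n + m) 0) t"
    unfolding t_def using Suc.IH[of "Suc m"] by simp
  finally show ?case
    by (simp only: t_def)
qed

subsection \<open>Chromatic polynomials and the Moebius function\<close>

lemma sum_Pow_minus_one_power_card:
  assumes "finite A"
  shows "(\<Sum>B\<in>Pow A. (-1) ^ card B :: int) = (if A = {} then 1 else 0)"
proof -
  have "(\<Sum>B\<in>Pow A. (-1) ^ card B :: int) = (\<Prod>x\<in>A. 1 + (-1))"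
    using prod_diff_conv_sum[OF assms, of "\<lambda>_. 1 :: int" "\<lambda>_. 1"] by simp
  then show ?thesis
    using assms by (auto simp: power_0_left)
qed

text \<open>Whitney's formula: the signed sum over subfamilies satisfies the recursion of the
  Moebius function. \<open>nontriv\<close> ensures that only the empty family has intersection
  \<open>V\<close>.\<close>

lemma moebius_intersection_lattice:
  assumes fin: "finite A" and nontriv: "\<And>H. H \<in> A \<Longrightarrow> \<not> V \<subseteq> H"
    and "Y \<in> carrier (intersection_lattice V A)"
  shows "moebius (intersection_lattice V A) V Y = (\<Sum>B | B \<subseteq> A \<and> V \<inter> \<Inter>B = Y. (-1) ^ card B)"
  using assms(3)
\<comment> \<open>The recursion for \<open>Y\<close> refers to strictly larger subspaces
  \<open>Z\<close>, and fewer lattice elements contain these.\<close>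
proof (induction "card {Z \<in> carrier (intersection_lattice V A). Y \<subseteq> Z}" arbitrary: Y rule: less_induct)
  case less
  let ?L = "intersection_lattice V A"
  let ?\<nu> = "\<lambda>Z. \<Sum>B | B \<subseteq> A \<and> V \<inter> \<Inter>B = Z. (-1) ^ card B :: int"
  define I where "I = {Z \<in> carrier ?L. Y \<subseteq> Z}"
  have finL: "finite (carrier ?L)"
    using fin by (rule finite_intersection_lattice)
  then have finI: "finite I"
    by (simp add: I_def)
  have Y: "Y \<in> I" "Y \<subseteq> V" "Y \<noteq> {}"
    using less.prems by (auto simp: I_def intersection_lattice_def)
  have V: "V \<in> carrier ?L"
    using Y by (auto simp: intersection_lattice_def intro!: exI[of _ "{}"])
  have interval: "\<lbrace>V..Y\<rbrace>\<^bsub>?L\<^esub> = I"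
    by (auto simp: at_least_at_most_def I_def intersection_lattice_def)
  have "V \<sqsubseteq>\<^bsub>?L\<^esub> Y"
    using Y by (simp add: intersection_lattice_def)
  then have mu: "moebius ?L V Y = (if V = Y then 1 else - (\<Sum>Z \<in> I - {Y}. moebius ?L V Z))"
    using partial_order_intersection_lattice[of V A] finI V less.prems
    by (subst moebius.simps) (simp add: interval)
  show ?case
  proof (cases "V = Y")
    case True
    then have "{B. B \<subseteq> A \<and> V \<inter> \<Inter>B = Y} = {{}}"
      using nontriv by blast
    with mu True show ?thesis
      by simp
  next
    case False
    let ?A = "{H \<in> A. Y \<subseteq> H}"
    obtain C where "C \<subseteq> A" "Y = V \<inter> \<Inter>C"
      using less.prems by (auto simp: intersection_lattice_def)
    then have "?A \<noteq> {}"
      using False by auto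
    \<comment> \<open>A family whose intersection contains \<open>Y\<close> consists of members of
      \<open>A\<close> that contain \<open>Y\<close>. Grouping by intersection turns the sum over
      the interval into an alternating sum over all subsets of \<open>?A\<close>, which
      vanishes.\<close>
    have "(\<Sum>Z\<in>I. ?\<nu> Z) = (\<Sum>Z\<in>I. \<Sum>B | B \<in> Pow ?A \<and> V \<inter> \<Inter>B = Z. (-1) ^ card B)"
      by (intro sum.cong refl) (auto simp: I_def)
    also have "\<dots> = (\<Sum>B\<in>Pow ?A. (-1) ^ card B)"
    proof (rule sum.group)
      show "(\<lambda>B. V \<inter> \<Inter>B) ` Pow ?A \<subseteq> I"
      proof (rule image_subsetI)
        fix B assume "B \<in> Pow ?A"
        then have "B \<subseteq> A" "Y \<subseteq> V \<inter> \<Inter>B"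
          using Y by auto
        moreover have "V \<inter> \<Inter>B \<noteq> {}"
          using \<open>Y \<subseteq> V \<inter> \<Inter>B\<close> Y(3) by blast
        moreover have "\<exists>C \<subseteq> A. V \<inter> \<Inter>B = V \<inter> \<Inter>C"
          using \<open>B \<subseteq> A\<close> by blast
        ultimately show "V \<inter> \<Inter>B \<in> I"
          by (simp add: I_def intersection_lattice_def)
      qed
    qed (use fin finI in auto)
    also have "\<dots> = 0"
      using \<open>?A \<noteq> {}\<close> fin by (subst sum_Pow_minus_one_power_card) auto
    finally have "?\<nu> Y = - (\<Sum>Z\<in>I - {Y}. ?\<nu> Z)"
      using finI Y(1) by (simp add: sum.remove)
    also have "(\<Sum>Z\<in>I - {Y}. ?\<nu> Z) = (\<Sum>Z\<in>I - {Y}. moebius ?L V Z)"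
    proof (rule sum.cong[OF refl])
      fix Z assume Z: "Z \<in> I - {Y}"
      then have "{X \<in> carrier ?L. Z \<subseteq> X} \<subset> {X \<in> carrier ?L. Y \<subseteq> X}"
        using less.prems by (auto simp: I_def)
      then have "card {X \<in> carrier ?L. Z \<subseteq> X} < card {X \<in> carrier ?L. Y \<subseteq> X}"
        using finL by (intro psubset_card_mono) auto
      then show "?\<nu> Z = moebius ?L V Z"
        using Z by (intro less.hyps[symmetric]) (auto simp: I_def)
    qed
    finally show ?thesis
      using mu False by simp
  qed
qed

section \<open>Connected components and proper colourings\<close>

definition component_rel :: "'a set \<Rightarrow> 'a rel \<Rightarrow> 'a rel" where
  "component_rel V B = {(u, v) \<in> V \<times> V. (u, v) \<in> (B \<union> B\<inverse>)\<^sup>*}"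

lemma equiv_component_rel: "equiv V (component_rel V B)"
proof (rule equivI)
  have "sym ((B \<union> B\<inverse>)\<^sup>*)"
    by (intro sym_rtrancl) (auto simp: sym_def)
  then show "sym (component_rel V B)"
    by (auto simp: component_rel_def sym_def)
  show "trans (component_rel V B)"
    by (auto simp: component_rel_def trans_def intro: rtrancl_trans)
qed (auto simp: component_rel_def refl_on_def)

lemma component_rel_eqD:
  assumes "(u, v) \<in> component_rel V B" "\<forall>(u, v) \<in> B. f u = f v"
  shows "f u = f v"
proof -
  have "(u, v) \<in> (B \<union> B\<inverse>)\<^sup>*"
    using assms(1) by (simp add: component_rel_def)
  then show ?thesis
    by induction (use assms(2) in auto)
qed

lemma component_rel_edge:
  assumes "(u, v) \<in> B" "B \<subseteq> V \<times> V"
  shows "(u, v) \<in> component_rel V B"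
  using assms by (auto simp: component_rel_def)

text \<open>A map that is constant along edges is constant on components, so it factors uniquely
  through the quotient.\<close>

lemma card_edge_constant_maps:
  assumes fin: "finite V" and B: "B \<subseteq> V \<times> V"
  shows "card {f \<in> V \<rightarrow>\<^sub>E T. \<forall>(u, v) \<in> B. f u = f v} = card T ^ card (V // component_rel V B)"
proof -
  let ?R = "component_rel V B"
  let ?h = "\<lambda>g. \<lambda>v\<in>V. g (?R `` {v})"
  have eq: "equiv V ?R"
    by (rule equiv_component_rel)
  have "bij_betw ?h (V // ?R \<rightarrow>\<^sub>E T) {f \<in> V \<rightarrow>\<^sub>E T. \<forall>(u, v) \<in> B. f u = f v}"
  proof (rule bij_betw_imageI)
    show "inj_on ?h (V // ?R \<rightarrow>\<^sub>E T)"
    proof (rule inj_onI)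
      fix g g' assume g: "g \<in> V // ?R \<rightarrow>\<^sub>E T" "g' \<in> V // ?R \<rightarrow>\<^sub>E T" and h: "?h g = ?h g'"
      have "g C = g' C" if C: "C \<in> V // ?R" for C
      proof -
        obtain v where v: "v \<in> V" "C = ?R `` {v}"
          using C unfolding quotient_def by blast
        then show ?thesis
          using fun_cong[OF h, of v] by simp
      qed
      then show "g = g'"
        using g by (intro PiE_ext) auto
    qed
  next
    show "?h ` (V // ?R \<rightarrow>\<^sub>E T) = {f \<in> V \<rightarrow>\<^sub>E T. \<forall>(u, v) \<in> B. f u = f v}" (is "_ = ?F")
    proof (rule equalityI; rule subsetI)
      fix f assume "f \<in> ?h ` (V // ?R \<rightarrow>\<^sub>E T)"
      then obtain g where g: "g \<in> V // ?R \<rightarrow>\<^sub>E T" "f = ?h g"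
        by blast
      have "f u = f v" if "(u, v) \<in> B" for u v
        using that B g(2) equiv_class_eq[OF eq component_rel_edge[OF that B]] by auto
      moreover have "f \<in> V \<rightarrow>\<^sub>E T"
        using g quotientI by fastforce
      ultimately show "f \<in> ?F"
        by auto
    next
      fix f assume f: "f \<in> ?F"
      define g where "g = (\<lambda>C \<in> V // ?R. f (SOME v. v \<in> C))"
      have some: "f (SOME w. w \<in> ?R `` {v}) = f v" if "v \<in> V" for v
      proof -
        have "v \<in> ?R `` {v}"
          using that eq by (rule equiv_class_self[rotated])
        then have "(v, SOME w. w \<in> ?R `` {v}) \<in> ?R"
          by (metis Image_singleton_iff someI_ex)
        then show ?thesis
          using f by (intro component_rel_eqD[symmetric]) auto
      qed
      have "g \<in> V // ?R \<rightarrow>\<^sub>E T"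
      proof (rule PiE_I)
        fix C assume C: "C \<in> V // ?R"
        then obtain v where "v \<in> V" "C = ?R `` {v}"
          unfolding quotient_def by blast
        then show "g C \<in> T"
          using C some f by (auto simp: g_def)
      qed (simp add: g_def)
      moreover have "?h g = f"
      proof
        fix v
        show "?h g v = f v"
        proof (cases "v \<in> V")
          case True
          then show ?thesis
            using some quotientI[of v V ?R] by (simp add: g_def)
        next
          case False
          moreover have "f \<in> V \<rightarrow>\<^sub>E T"
            using f by simp
          ultimately show ?thesis
            using PiE_arb[of f V "\<lambda>_. T" v] by simp
        qed
      qed
      ultimately show "f \<in> ?h ` (V // ?R \<rightarrow>\<^sub>E T)"
        by blast
    qed
  qed
  then have "card {f \<in> V \<rightarrow>\<^sub>E T. \<forall>(u, v) \<in> B. f u = f v} = card (V // ?R \<rightarrow>\<^sub>E T)"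
    by (rule bij_betw_same_card[symmetric])
  also have "\<dots> = card T ^ card (V // ?R)"
  proof (rule card_funcsetE)
    show "finite (V // ?R)"
      using fin by (rule finite_quotient) (auto simp: component_rel_def)
  qed
  finally show ?thesis .
qed

text \<open>Whitney's expansion of the chromatic polynomial: inclusion-exclusion over the sets of
  edges forced to be monochromatic.\<close>

lemma card_proper_colourings:
  assumes V: "finite V" and T: "finite T" and E: "E \<subseteq> V \<times> V"
  shows "int (card {f \<in> V \<rightarrow>\<^sub>E T. \<forall>(u, v) \<in> E. f u \<noteq> f v})
       = (\<Sum>B\<in>Pow E. (-1) ^ card B * int (card T) ^ card (V // component_rel V B))"
proof -
  let ?C = "V \<rightarrow>\<^sub>E T"
  have fin: "finite ?C" "finite E"
    using V T E by (auto intro: finite_PiE finite_subset)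
  have "(\<Sum>B\<in>Pow E. (-1) ^ card B * int (card T) ^ card (V // component_rel V B))
      = (\<Sum>B\<in>Pow E. (-1) ^ card B * int (card {f \<in> ?C. \<forall>(u, v) \<in> B. f u = f v}))"
    using E V by (intro sum.cong refl) (subst card_edge_constant_maps, auto)
  also have "\<dots> = (\<Sum>B\<in>Pow E. \<Sum>f\<in>?C. if \<forall>(u, v) \<in> B. f u = f v then (-1) ^ card B else 0)"
    using fin(1) by (intro sum.cong refl) (simp add: sum.If_cases Int_def mult.commute)
  also have "\<dots> = (\<Sum>f\<in>?C. \<Sum>B\<in>Pow E. if \<forall>(u, v) \<in> B. f u = f v then (-1) ^ card B else 0)"
    by (rule sum.swap)
  also have "\<dots> = (\<Sum>f\<in>?C. if \<forall>(u, v) \<in> E. f u \<noteq> f v then 1 else 0)"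
  proof (rule sum.cong[OF refl])
    fix f
    \<comment> \<open>For a fixed colouring, the contributing \<open>B\<close> are the subsets of
      its monochromatic edges; their signs cancel unless there is no such edge.\<close>
    let ?E = "{(u, v) \<in> E. f u = f v}"
    have "(\<Sum>B\<in>Pow E. if \<forall>(u, v) \<in> B. f u = f v then (-1) ^ card B else 0 :: int)
        = (\<Sum>B\<in>Pow ?E. (-1) ^ card B)"
      using fin(2) by (intro sum.mono_neutral_cong_right) auto
    also have "\<dots> = (if ?E = {} then 1 else 0)"
      using fin(2) by (intro sum_Pow_minus_one_power_card) (auto intro: finite_subset[rotated])
    also have "?E = {} \<longleftrightarrow> (\<forall>(u, v) \<in> E. f u \<noteq> f v)"
      by auto
    finally show "(\<Sum>B\<in>Pow E. if \<forall>(u, v) \<in> B. f u = f v then (-1) ^ card B else 0 :: int)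
        = (if \<forall>(u, v) \<in> E. f u \<noteq> f v then 1 else 0)" .
  qed
  also have "\<dots> = int (card {f \<in> ?C. \<forall>(u, v) \<in> E. f u \<noteq> f v})"
    using fin(1) by (simp add: sum.If_cases Int_def)
  finally show ?thesis
    by simp
qed

text \<open>Connectedness is phrased through real functions because these arise as coordinates of
  points lying on the hyperplanes.\<close>

lemma card_components_eq_1_iff:
  assumes "V \<noteq> {}" and B: "B \<subseteq> V \<times> V"
  shows "card (V // component_rel V B) = 1 \<longleftrightarrow>
    (\<forall>p :: 'a \<Rightarrow> real. (\<forall>(u, v) \<in> B. p u = p v) \<longrightarrow> (\<forall>u\<in>V. \<forall>v\<in>V. p u = p v))"
  (is "?lhs \<longleftrightarrow> ?rhs")
proof
  let ?R = "component_rel V B"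
  assume ?lhs
  then obtain C where C: "V // ?R = {C}"
    by (rule card_1_singletonE)
  have connected: "(u, v) \<in> ?R" if "u \<in> V" "v \<in> V" for u v
  proof -
    have "?R `` {u} = ?R `` {v}"
      using C quotientI[OF that(1), of ?R] quotientI[OF that(2), of ?R] by simp
    then show ?thesis
      using that by (intro eq_equiv_class[OF _ equiv_component_rel])
  qed
  show ?rhs
  proof (intro allI impI)
    fix p :: "'a \<Rightarrow> real"
    assume p: "\<forall>(u, v) \<in> B. p u = p v"
    show "\<forall>u\<in>V. \<forall>v\<in>V. p u = p v"
      using connected by (intro ballI component_rel_eqD[OF _ p])
  qed
next
  let ?R = "component_rel V B"
  assume rhs: ?rhs
  obtain w where w: "w \<in> V"
    using assms(1) by blast
  have eq: "equiv V ?R"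
    by (rule equiv_component_rel)
  then have R_sym: "sym ?R" and R_trans: "trans ?R"
    by (simp_all add: equiv_def)
  \<comment> \<open>The indicator of the component of \<open>w\<close> is constant along edges,
    hence constant, so that component is everything.\<close>
  let ?p = "\<lambda>v. of_bool ((w, v) \<in> ?R) :: real"
  have "\<forall>(u, v) \<in> B. ?p u = ?p v"
  proof clarify
    fix u v assume uv: "(u, v) \<in> B"
    have "(w, u) \<in> ?R \<longleftrightarrow> (w, v) \<in> ?R"
      using component_rel_edge[OF uv B] symD[OF R_sym] transD[OF R_trans] by blast
    then show "?p u = ?p v"
      by simp
  qed
  then have all: "\<forall>u\<in>V. \<forall>v\<in>V. ?p u = ?p v"
    by (rule rhs[THEN spec, THEN mp])
  have "?p w = ?p v" if "v \<in> V" for v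
    by (rule bspec[OF bspec[OF all w] that])
  moreover have "(w, w) \<in> ?R"
    using w by (simp add: component_rel_def)
  ultimately have "(w, v) \<in> ?R" if "v \<in> V" for v
    using that by simp
  then have "?R `` {v} = ?R `` {w}" if "v \<in> V" for v
    using that equiv_class_eq[OF eq] by blast
  then have "V // ?R = (\<Union>v\<in>V. {?R `` {w}})"
    unfolding quotient_def by (intro SUP_cong refl) simp
  also have "\<dots> = {?R `` {w}}"
    using w by blast
  finally show ?lhs
    by (metis is_singletonI is_singleton_altdef)
qed

lemma poly_eqI_nat:
  fixes p q :: "int poly"
  assumes "\<And>t :: nat. poly p (int t) = poly q (int t)"
  shows "p = q"
proof (rule ccontr)
  assume "p \<noteq> q"
  then have "finite {x. poly (p - q) x = 0}"
    by (intro poly_roots_finite) simp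
  moreover have "range int \<subseteq> {x. poly (p - q) x = 0}"
    using assms by auto
  ultimately have "finite (range int)"
    by (rule finite_subset[rotated])
  then show False
    by (simp add: finite_image_iff)
qed

section \<open>The Ferrers graph and its colourings\<close>

text \<open>\<open>Inl i\<close> stands for \<open>a\<^sub>i\<close> and \<open>Inr j\<close> for \<open>b\<^sub>j\<close>.\<close>

definition ferrers_vertices :: "nat \<Rightarrow> (nat + nat) set" where
  "ferrers_vertices n = Inl ` {1..n} \<union> Inr ` {2..n + 1}"

text \<open>One edge per hyperplane. \<open>Inr 1\<close> and \<open>Inl (n + 1)\<close> would be
  isolated, which is why they are not among the vertices: otherwise the graph could not be
  connected.\<close>

definition ferrers_edges :: "nat \<Rightarrow> (nat + nat) rel" where
  "ferrers_edges n = {(Inl i, Inr j) | i j. 1 \<le> i \<and> i < j \<and> j \<le> n + 1}"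

lemma finite_ferrers_vertices: "finite (ferrers_vertices n)"
  by (simp add: ferrers_vertices_def)

lemma ferrers_edges_subset: "ferrers_edges n \<subseteq> ferrers_vertices n \<times> ferrers_vertices n"
  by (auto simp: ferrers_edges_def ferrers_vertices_def)

lemma finite_ferrers_edges: "finite (ferrers_edges n)"
  using ferrers_edges_subset finite_ferrers_vertices by (metis finite_SigmaI finite_subset)

text \<open>The graph is connected through two hubs: b_{n+1} is adjacent to every a_i, and a_1 to
  every b_j.\<close>

lemma ferrers_connected:
  assumes "\<forall>(u, v) \<in> ferrers_edges n. p u = p v" "u \<in> ferrers_vertices n" "v \<in> ferrers_vertices n"
  shows "p u = p v"
proof -
  have e: "p (Inl i) = p (Inr j)" if "1 \<le> i" "i < j" "j \<le> n + 1" for i j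
    using assms(1) that by (auto simp: ferrers_edges_def)
  have "p w = p (Inl 1)" if "w \<in> ferrers_vertices n" for w
  proof (cases w)
    case (Inl i)
    then have "i \<in> {1..n}"
      using that by (auto simp: ferrers_vertices_def)
    then have "p (Inl i) = p (Inr (n + 1))" "p (Inl 1) = p (Inr (n + 1))"
      by (auto intro!: e)
    with Inl show ?thesis
      by simp
  next
    case (Inr j)
    then have "j \<in> {2..n + 1}"
      using that by (auto simp: ferrers_vertices_def)
    then have "p (Inl 1) = p (Inr j)"
      by (auto intro!: e)
    with Inr show ?thesis
      by simp
  qed
  from this[OF assms(2)] this[OF assms(3)] show ?thesis
    by simp
qed

text \<open>Colour the a's first. The b's are pairwise non-adjacent, so each b_j then independently
  avoids the colours of a_1, ..., a_{j-1}.\<close>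

lemma card_ferrers_colourings:
  assumes T: "finite T"
  shows "int (card {f \<in> ferrers_vertices n \<rightarrow>\<^sub>E T. \<forall>(u, v) \<in> ferrers_edges n. f u \<noteq> f v})
       = poly (ferrers_poly n 0) (int (card T))"
proof -
  let ?V = "ferrers_vertices n"
  let ?b = "\<lambda>a. \<Pi>\<^sub>E j \<in> {2..n + 1}. T - a ` {1..<j}"
  let ?split = "\<lambda>f. (\<lambda>i\<in>{1..n}. f (Inl i), \<lambda>j\<in>{2..n + 1}. f (Inr j))"
  let ?join = "\<lambda>(a, b). \<lambda>v\<in>?V. case_sum a b v"
  have "bij_betw ?split {f \<in> ?V \<rightarrow>\<^sub>E T. \<forall>(u, v) \<in> ferrers_edges n. f u \<noteq> f v}
          (SIGMA a : {1..n} \<rightarrow>\<^sub>E T. ?b a)"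
  proof (rule bij_betwI[where g = ?join])
    show "?split \<in> {f \<in> ?V \<rightarrow>\<^sub>E T. \<forall>(u, v) \<in> ferrers_edges n. f u \<noteq> f v} \<rightarrow>
        (SIGMA a : {1..n} \<rightarrow>\<^sub>E T. ?b a)"
    proof
      fix f assume "f \<in> {f \<in> ?V \<rightarrow>\<^sub>E T. \<forall>(u, v) \<in> ferrers_edges n. f u \<noteq> f v}"
      then have f: "f \<in> ?V \<rightarrow>\<^sub>E T" "\<forall>(u, v) \<in> ferrers_edges n. f u \<noteq> f v"
        by simp_all
      have fl: "f (Inl i) \<in> T" if "i \<in> {1..n}" for i
        using that by (intro PiE_mem[OF f(1)]) (simp add: ferrers_vertices_def)
      have fr: "f (Inr j) \<in> T" if "j \<in> {2..n + 1}" for j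
        using that by (intro PiE_mem[OF f(1)]) (simp add: ferrers_vertices_def)
      have ne: "f (Inl i) \<noteq> f (Inr j)" if "1 \<le> i" "i < j" "j \<le> n + 1" for i j
        using bspec[OF f(2), of "(Inl i, Inr j)"] that by (simp add: ferrers_edges_def)
      have "f (Inr j) \<in> T - (\<lambda>i\<in>{1..n}. f (Inl i)) ` {1..<j}" if j: "j \<in> {2..n + 1}" for j
      proof
        show "f (Inr j) \<notin> (\<lambda>i\<in>{1..n}. f (Inl i)) ` {1..<j}"
        proof
          assume "f (Inr j) \<in> (\<lambda>i\<in>{1..n}. f (Inl i)) ` {1..<j}"
          then obtain i where "i \<in> {1..<j}" "f (Inr j) = (\<lambda>i\<in>{1..n}. f (Inl i)) i"
            by blast
          then show False
            using j ne[of i j] by simp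
        qed
      qed (rule fr[OF j])
      then show "?split f \<in> (SIGMA a : {1..n} \<rightarrow>\<^sub>E T. ?b a)"
        using fl by (intro SigmaI PiE_I) (simp_all only: restrict_PiE restrict_apply simp_thms if_True if_False)
    qed
  next
    show "?join \<in> (SIGMA a : {1..n} \<rightarrow>\<^sub>E T. ?b a) \<rightarrow>
        {f \<in> ?V \<rightarrow>\<^sub>E T. \<forall>(u, v) \<in> ferrers_edges n. f u \<noteq> f v}"
    proof
      fix ab assume "ab \<in> (SIGMA a : {1..n} \<rightarrow>\<^sub>E T. ?b a)"
      then obtain a b where ab: "ab = (a, b)" "a \<in> {1..n} \<rightarrow>\<^sub>E T" "b \<in> ?b a"
        by auto
      have bj: "b j \<in> T - a ` {1..<j}" if "j \<in> {2..n + 1}" for j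
        using ab(3) that by (rule PiE_mem)
      have "a i \<noteq> b j" if "1 \<le> i" "i < j" "j \<le> n + 1" for i j
      proof -
        have "a i \<in> a ` {1..<j}"
          using that by (intro imageI) simp
        then show ?thesis
          using bj[of j] that by fastforce
      qed
      then have "\<forall>(u, v) \<in> ferrers_edges n. ?join ab u \<noteq> ?join ab v"
        by (auto simp: ab(1) ferrers_edges_def ferrers_vertices_def)
      moreover have "?join ab \<in> ?V \<rightarrow>\<^sub>E T"
        using ab(2) bj by (auto simp: ab(1) ferrers_vertices_def)
      ultimately show "?join ab \<in> {f \<in> ?V \<rightarrow>\<^sub>E T. \<forall>(u, v) \<in> ferrers_edges n. f u \<noteq> f v}"
        by blast
    qed
  next
    fix f assume "f \<in> {f \<in> ?V \<rightarrow>\<^sub>E T. \<forall>(u, v) \<in> ferrers_edges n. f u \<noteq> f v}"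
    then have f: "f \<in> ?V \<rightarrow>\<^sub>E T"
      by simp
    have "?join (?split f) v = f v" for v
      using PiE_arb[OF f, of v] by (cases v) (auto simp: ferrers_vertices_def)
    then show "?join (?split f) = f"
      by blast
  next
    fix ab assume "ab \<in> (SIGMA a : {1..n} \<rightarrow>\<^sub>E T. ?b a)"
    then obtain a b where ab: "ab = (a, b)" "a \<in> {1..n} \<rightarrow>\<^sub>E T" "b \<in> ?b a"
      by auto
    have "(\<lambda>i\<in>{1..n}. ?join ab (Inl i)) = a" "(\<lambda>j\<in>{2..n + 1}. ?join ab (Inr j)) = b"
      using PiE_arb[OF ab(2)] PiE_arb[OF ab(3)]
      by (auto simp: ab(1) ferrers_vertices_def fun_eq_iff)
    then show "?split (?join ab) = ab"
      by (simp add: ab(1))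
  qed
  then have "card {f \<in> ?V \<rightarrow>\<^sub>E T. \<forall>(u, v) \<in> ferrers_edges n. f u \<noteq> f v}
      = card (SIGMA a : {1..n} \<rightarrow>\<^sub>E T. ?b a)"
    by (rule bij_betw_same_card)
  also have "\<dots> = (\<Sum>a \<in> {1..n} \<rightarrow>\<^sub>E T. card (?b a))"
    using T by (intro card_SigmaI) (auto intro!: finite_PiE)
  finally have "int (card {f \<in> ?V \<rightarrow>\<^sub>E T. \<forall>(u, v) \<in> ferrers_edges n. f u \<noteq> f v})
      = (\<Sum>a \<in> {1..n} \<rightarrow>\<^sub>E T. int (card (?b a)))"
    by simp
  also have "\<dots> = (\<Sum>a \<in> {1..n} \<rightarrow>\<^sub>E T. \<Prod>j=1..n. int (card T) - int (card (a ` {1..j})))"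
  proof (rule sum.cong[OF refl])
    fix a assume a: "a \<in> {1..n} \<rightarrow>\<^sub>E T"
    have "int (card (?b a)) = (\<Prod>j=Suc 1..Suc n. int (card (T - a ` {1..<j})))"
      by (simp add: card_PiE numeral_2_eq_2)
    also have "\<dots> = (\<Prod>j=1..n. int (card (T - a ` {1..<Suc j})))"
      by (rule prod.shift_bounds_cl_Suc_ivl)
    also have "\<dots> = (\<Prod>j=1..n. int (card T) - int (card (a ` {1..j})))"
    proof (rule prod.cong[OF refl])
      fix j assume "j \<in> {1..n}"
      then have "a ` {1..j} \<subseteq> T"
        using a by auto
      then show "int (card (T - a ` {1..<Suc j})) = int (card T) - int (card (a ` {1..j}))"
        using T by (simp add: card_Diff_subset card_mono of_nat_diff atLeastLessThanSuc_atLeastAtMost)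
    qed
    finally show "int (card (?b a)) = (\<Prod>j=1..n. int (card T) - int (card (a ` {1..j})))" .
  qed
  also have "\<dots> = poly (ferrers_poly n 0) (int (card T))"
    using sum_PiE_ferrers_poly[OF T, of n 0] by simp
  finally show ?thesis .
qed

text \<open>Whitney's expansion and the colouring recursion agree at every natural number, hence as
  polynomials. The linear coefficient of the former singles out the edge sets with one
  component.\<close>

lemma sum_connected_ferrers_subgraphs:
  assumes "n \<ge> 1"
  shows "(\<Sum>B | B \<subseteq> ferrers_edges n \<and>
              card (ferrers_vertices n // component_rel (ferrers_vertices n) B) = 1. (-1) ^ card B)
       = - int (genocchi n)"
proof -
  let ?V = "ferrers_vertices n" and ?E = "ferrers_edges n"
  let ?c = "\<lambda>B. card (?V // component_rel ?V B)"
  let ?P = "\<Sum>B\<in>Pow ?E. monom ((-1) ^ card B) (?c B) :: int poly"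
  have "?P = ferrers_poly n 0"
  proof (rule poly_eqI_nat)
    fix t :: nat
    have "poly ?P (int t) = (\<Sum>B\<in>Pow ?E. (-1) ^ card B * int (card {..<t}) ^ ?c B)"
      by (simp add: poly_sum poly_monom)
    also have "\<dots> = poly (ferrers_poly n 0) (int (card {..<t}))"
      using card_proper_colourings[OF finite_ferrers_vertices _ ferrers_edges_subset, of "{..<t}" n]
        card_ferrers_colourings[of "{..<t}" n] by (simp only: finite_lessThan)
    finally show "poly ?P (int t) = poly (ferrers_poly n 0) (int t)"
      by simp
  qed
  then have "coeff ?P 1 = - int (genocchi n)"
    using coeff_ferrers_poly[OF assms] by simp
  moreover have "coeff ?P 1 = (\<Sum>B | B \<subseteq> ?E \<and> ?c B = 1. (-1) ^ card B)"
    using finite_ferrers_edges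
    by (simp add: coeff_sum sum.If_cases Int_def)
  ultimately show ?thesis
    by simp
qed

section \<open>From intersections of hyperplanes to connected edge sets\<close>

definition potential :: "nat \<Rightarrow> real vec \<Rightarrow> nat + nat \<Rightarrow> real" where
  "potential n w = case_sum (\<lambda>i. w $ (i - 1) - w $ (n + i)) (\<lambda>j. w $ (j - 1))"

text \<open>The change of variables can realise any values on the vertices: put x_j = b_j for j
  \<ge> 2 and solve y_i = x_i - a_i.\<close>

lemma potential_surj:
  "\<exists>w \<in> carrier_vec (2 * n + 2). \<forall>u \<in> ferrers_vertices n. potential n w u = p u"
proof
  \<comment> \<open>Indices start at 0, so \<open>x k\<close> is x_{k+1}. No vertex prescribes x_1,
    so it is set to 0.\<close>
  define x where "x k = (if k = 0 then 0 else p (Inr (Suc k)))" for k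
  define w where "w = vec (2 * n + 2) (\<lambda>k. if k \<le> n then x k else x (k - n - 1) - p (Inl (k - n)))"
  show "w \<in> carrier_vec (2 * n + 2)"
    by (simp add: w_def)
  have "potential n w (Inl i) = p (Inl i)" if "i \<in> {1..n}" for i
  proof -
    have "w $ (i - 1) = x (i - 1)"
      unfolding w_def using that by (subst index_vec) auto
    moreover have "w $ (n + i) = x (i - 1) - p (Inl i)"
      unfolding w_def using that by (subst index_vec) auto
    ultimately show ?thesis
      by (simp add: potential_def)
  qed
  moreover have "potential n w (Inr j) = p (Inr j)" if "j \<in> {2..n + 1}" for j
  proof -
    have "w $ (j - 1) = x (j - 1)"
      unfolding w_def using that by (subst index_vec) auto
    then show ?thesis
      using that by (simp add: potential_def x_def)
  qed
  ultimately show "\<forall>u \<in> ferrers_vertices n. potential n w u = p u"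
    by (auto simp: ferrers_vertices_def)
qed

definition edge_hyperplane :: "nat \<Rightarrow> (nat + nat) \<times> (nat + nat) \<Rightarrow> real vec set" where
  "edge_hyperplane n = (\<lambda>(u, v). {w \<in> carrier_vec (2 * n + 2). potential n w u = potential n w v})"

lemma linial_arrangement_eq: "linial_arrangement n = edge_hyperplane n ` ferrers_edges n"
proof -
  have "linial_hyperplane n i j = edge_hyperplane n (Inl i, Inr j)" for i j
    by (auto simp: linial_hyperplane_def edge_hyperplane_def potential_def)
  then show ?thesis
    unfolding linial_arrangement_def ferrers_edges_def by blast
qed

text \<open>Yields injectivity of \<open>edge_hyperplane n\<close> on the edges, so that passing
  from edge sets to sets of hyperplanes keeps cardinalities and hence signs.\<close>

lemma edge_hyperplane_not_subset:
  assumes "e \<in> ferrers_edges n" "e' \<in> ferrers_edges n" "e \<noteq> e'"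
  shows "\<not> edge_hyperplane n e \<subseteq> edge_hyperplane n e'"
proof -
  obtain i j where e: "e = (Inl i, Inr j)"
    using assms(1) by (auto simp: ferrers_edges_def)
  obtain i' j' where e': "e' = (Inl i', Inr j')"
    using assms(2) by (auto simp: ferrers_edges_def)
  \<comment> \<open>The b's get distinct nonnegative values, a_i gets the value of b_j, and every
    other a gets a value no b has. Equality thus holds along the edge \<open>e\<close> and no
    other.\<close>
  define p :: "nat + nat \<Rightarrow> real"
    where "p = case_sum (\<lambda>k. if k = i then real j else - 1) real"
  obtain w where w: "w \<in> carrier_vec (2 * n + 2)" "\<forall>u \<in> ferrers_vertices n. potential n w u = p u"
    using potential_surj by blast
  have "fst e \<in> ferrers_vertices n" "snd e \<in> ferrers_vertices n"
    "fst e' \<in> ferrers_vertices n" "snd e' \<in> ferrers_vertices n"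
    using assms(1,2) ferrers_edges_subset by force+
  then have "w \<in> edge_hyperplane n e" "w \<in> edge_hyperplane n e' \<longleftrightarrow> p (Inl i') = p (Inr j')"
    using w by (auto simp: edge_hyperplane_def e e' p_def)
  moreover have "p (Inl i') \<noteq> p (Inr j')"
    using assms(3) by (auto simp: e e' p_def)
  ultimately show ?thesis
    by blast
qed

text \<open>As the Ferrers graph is connected, the full intersection consists of the points with
  constant potential. Every function on the vertices is a potential, so \<open>B\<close> already
  cuts out this space iff functions constant along \<open>B\<close> are constant.\<close>

lemma inter_edge_hyperplanes_eq_top_iff:
  assumes "n \<ge> 1" and B: "B \<subseteq> ferrers_edges n"
  shows "carrier_vec (2 * n + 2) \<inter> \<Inter>(edge_hyperplane n ` B)
           = carrier_vec (2 * n + 2) \<inter> \<Inter>(linial_arrangement n)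
     \<longleftrightarrow> card (ferrers_vertices n // component_rel (ferrers_vertices n) B) = 1"
proof -
  let ?V = "ferrers_vertices n" and ?E = "ferrers_edges n" and ?S = "carrier_vec (2 * n + 2) :: real vec set"
  have inter: "?S \<inter> \<Inter>(edge_hyperplane n ` C) = {w \<in> ?S. \<forall>(u, v) \<in> C. potential n w u = potential n w v}" for C
    by (auto simp: edge_hyperplane_def)
  have B': "B \<subseteq> ?V \<times> ?V"
    using B ferrers_edges_subset by blast
  have ne: "?V \<noteq> {}"
    using assms(1) by (auto simp: ferrers_vertices_def)
  have "?S \<inter> \<Inter>(edge_hyperplane n ` B) = ?S \<inter> \<Inter>(linial_arrangement n) \<longleftrightarrow>
      (\<forall>w\<in>?S. (\<forall>(u, v) \<in> B. potential n w u = potential n w v) \<longrightarrow>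
              (\<forall>(u, v) \<in> ?E. potential n w u = potential n w v))"
    unfolding linial_arrangement_eq inter using B by blast
  also have "\<dots> \<longleftrightarrow> (\<forall>p :: _ \<Rightarrow> real. (\<forall>(u, v) \<in> B. p u = p v) \<longrightarrow> (\<forall>u\<in>?V. \<forall>v\<in>?V. p u = p v))"
    (is "?L \<longleftrightarrow> ?R")
  proof
    assume L: ?L
    show ?R
    proof (intro allI impI ballI)
      fix p :: "nat + nat \<Rightarrow> real" and u v
      assume p: "\<forall>(u, v) \<in> B. p u = p v" and uv: "u \<in> ?V" "v \<in> ?V"
      obtain w where w: "w \<in> ?S" "\<forall>u \<in> ?V. potential n w u = p u"
        using potential_surj by blast
      have "potential n w a = potential n w b" if ab: "(a, b) \<in> B" for a b
      proof -
        have "a \<in> ?V" "b \<in> ?V" "p a = p b"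
          using B' p ab by auto
        then show ?thesis
          using w(2) by simp
      qed
      then have "\<forall>(a, b) \<in> B. potential n w a = potential n w b"
        by blast
      then have "\<forall>(a, b) \<in> ?E. potential n w a = potential n w b"
        by (rule L[THEN bspec, OF w(1), THEN mp])
      then have "potential n w u = potential n w v"
        using uv by (rule ferrers_connected)
      then show "p u = p v"
        using w(2) uv by simp
    qed
  next
    assume R: ?R
    show ?L
    proof (intro ballI impI)
      fix w and e :: "(nat + nat) \<times> (nat + nat)"
      assume "\<forall>(u, v) \<in> B. potential n w u = potential n w v" and "e \<in> ?E"
      moreover have "fst e \<in> ?V" "snd e \<in> ?V"
        using \<open>e \<in> ?E\<close> ferrers_edges_subset by force+
      ultimately have "potential n w (fst e) = potential n w (snd e)"
        using R by simp
      then show "case e of (u, v) \<Rightarrow> potential n w u = potential n w v"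
        by (simp add: case_prod_unfold)
    qed
  qed
  also have "\<dots> \<longleftrightarrow> card (?V // component_rel ?V B) = 1"
    using card_components_eq_1_iff[OF ne B'] by simp
  finally show ?thesis .
qed

lemma moebius_linial_lattice:
  assumes n: "n \<ge> 1"
  shows "moebius (linial_lattice n) \<bottom>\<^bsub>linial_lattice n\<^esub> \<top>\<^bsub>linial_lattice n\<^esub> = - int (genocchi n)"
proof -
  let ?S = "carrier_vec (2 * n + 2) :: real vec set" and ?A = "linial_arrangement n" and ?E = "ferrers_edges n"
  let ?h = "edge_hyperplane n"
  have inj: "inj_on ?h ?E"
    using edge_hyperplane_not_subset by (metis inj_onI subset_refl)
  have nontriv: "\<not> ?S \<subseteq> H" if H: "H \<in> ?A" for H
  proof -
    obtain i j where ij: "H = ?h (Inl i, Inr j)" "(Inl i, Inr j) \<in> ?E"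
      using H by (auto simp: linial_arrangement_eq ferrers_edges_def)
    \<comment> \<open>A point with all a's equal to 0 and all b's equal to 1 avoids every
      hyperplane.\<close>
    obtain w where "w \<in> ?S" "\<forall>u \<in> ferrers_vertices n. potential n w u = case_sum (\<lambda>_. 0) (\<lambda>_. 1) u"
      using potential_surj by blast
    moreover have "Inl i \<in> ferrers_vertices n" "Inr j \<in> ferrers_vertices n"
      using ij(2) ferrers_edges_subset by blast+
    ultimately show ?thesis
      by (auto simp: ij(1) edge_hyperplane_def)
  qed
  have "0\<^sub>v (2 * n + 2) \<in> ?S \<inter> \<Inter>?A"
    by (auto simp: linial_arrangement_def linial_hyperplane_def)
  then have "?S \<inter> \<Inter>?A \<noteq> {}"
    by (metis empty_iff)
  moreover have "\<exists>B \<subseteq> ?A. ?S \<inter> \<Inter>?A = ?S \<inter> \<Inter>B"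
    by (intro exI[of _ ?A]) simp
  ultimately have "?S \<inter> \<Inter>?A \<in> carrier (intersection_lattice ?S ?A)"
    by (simp add: intersection_lattice_def)
  then have "moebius (linial_lattice n) \<bottom>\<^bsub>linial_lattice n\<^esub> \<top>\<^bsub>linial_lattice n\<^esub>
      = (\<Sum>B | B \<subseteq> ?A \<and> ?S \<inter> \<Inter>B = ?S \<inter> \<Inter>?A. (-1) ^ card B)"
    unfolding bottom_linial_lattice top_linial_lattice unfolding linial_lattice_def
    by (intro moebius_intersection_lattice finite_linial_arrangement nontriv)
  \<comment> \<open>The sum moves from sets of hyperplanes to sets of edges.\<close>
  also have "{B. B \<subseteq> ?A \<and> ?S \<inter> \<Inter>B = ?S \<inter> \<Inter>?A}
      = image ?h ` {B. B \<subseteq> ?E \<and> ?S \<inter> \<Inter>(?h ` B) = ?S \<inter> \<Inter>?A}"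
    unfolding linial_arrangement_eq by (auto elim!: subset_imageE)
  also have "(\<Sum>B\<in>\<dots>. (-1) ^ card B :: int)
      = (\<Sum>B | B \<subseteq> ?E \<and> ?S \<inter> \<Inter>(?h ` B) = ?S \<inter> \<Inter>?A. (-1) ^ card (?h ` B))"
    by (subst sum.reindex) (auto intro: inj_on_subset[OF inj_on_image_Pow[OF inj]])
  also have "\<dots> = (\<Sum>B | B \<subseteq> ?E \<and>
        card (ferrers_vertices n // component_rel (ferrers_vertices n) B) = 1. (-1) ^ card B)"
    using inter_edge_hyperplanes_eq_top_iff[OF n] inj
    by (intro sum.cong) (auto simp: card_image inj_on_subset)
  also have "\<dots> = - int (genocchi n)"
    using n by (rule sum_connected_ferrers_subgraphs)
  finally show ?thesis .
qed

theorem theorem3p6: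
  fixes n :: nat
  assumes "n \<ge> 1"
  shows "moebius (linial_lattice n) \<bottom>\<^bsub>linial_lattice n\<^esub> \<top>\<^bsub>linial_lattice n\<^esub> = - int (card (D_cycles (2 * n)))
       \<and> - int (card (D_cycles (2 * n))) = - int (genocchi n)"
  using moebius_linial_lattice[OF assms] card_D_cycles[OF assms] by simp

end
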